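(* $$\sum_{k=0}^{\infty}(3k+2)\frac{(1)_k^3}{\left(\frac{3}{2}\right)_k^3\,4^k}\left\{H_{2k+1}^{(2)}-\frac{5}{4}H_{k}^{(2)}\right\}=\frac{\pi^4}{48}.$$
   Context: For a complex number $x$ and a nonnegative integer $n$, the shifted factorial is $(x)_n=\Gamma(x+n)/\Gamma(x)$, i.e. $(x)_0=1$ and $(x)_n=x(x+1)\cdots(x+n-1)$ for $n\ge 1$; $(x)_k^3$ means $((x)_k)^3$. The harmonic number of order two is $H_n^{(2)}=\sum_{j=1}^{n}\frac{1}{j^2}$, with $H_0^{(2)}=0$. *)

theory Defs
  imports "HOL-Analysis.Analysis"
begin

definition harmonic2 :: "nat \<Rightarrow> real" where
  "harmonic2 n = (\<Sum>j=1..n. 1 / (real j)\<^sup>2)"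

end

theory Submission
  imports Defs "HOL-Real_Asymp.Real_Asymp"
begin

text \<open>
  With \<open>y = x\<^sup>2\<close>, the identity is the coefficient of \<open>y\<close> in the acceleration of
  \<open>\<Sum>n. 2 / ((2n + 1)\<^sup>2 - y)\<close> obtained from
  \<open>A\<^sub>k = \<Sum>n. \<Prod>j\<le>k. 1 / ((2n + 2j + 1)\<^sup>2 - y)\<close> and the recurrence
  \<open>(4k + 2) A\<^sub>k = (3k + 2) (\<Prod>j\<le>k. 1 / ((2j + 1)\<^sup>2 - y)) + 4 (k + 1) ((k + 1)\<^sup>2 - y) A\<^bsub>k+1\<^esub>\<close>,
  whose summand telescopes in \<open>n\<close>. Taking that coefficient termwise yields a Wilf--Zeilberger
  pair with harmonic factors, which equates the series with
  \<open>\<Sum>n. 2 / (2n + 1)\<^sup>4\<close>. The latter is \<open>pi\<^sup>4 / 48\<close>, by differentiating the logarithm of the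
  reflection formula of the Gamma function four times at \<open>1/2\<close>.
\<close>

section \<open>Polygamma reflection formulas and the sum of inverse odd fourth powers\<close>

text \<open>Each polygamma reflection formula below comes from the preceding one by differentiating
  both sides; openness of \<open>S\<close> makes agreement on \<open>S\<close> enough to transfer
  the derivative.\<close>

lemma DERIV_eq_on_open:
  fixes f g f' g' :: "real \<Rightarrow> real"
  assumes "open S" and eq: "\<And>x. x \<in> S \<Longrightarrow> f x = g x"
    and f: "\<And>x. x \<in> S \<Longrightarrow> (f has_real_derivative f' x) (at x)"
    and g: "\<And>x. x \<in> S \<Longrightarrow> (g has_real_derivative g' x) (at x)"
    and "x \<in> S"
  shows "f' x = g' x"
proof (rule DERIV_unique)
  show "(f has_real_derivative f' x) (at x)" using f \<open>x \<in> S\<close> .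
  show "(f has_real_derivative g' x) (at x)"
    by (rule has_field_derivative_transform_within_open[OF g \<open>open S\<close>])
       (use \<open>x \<in> S\<close> eq in auto)
qed

lemma sin_pi_pos:
  fixes x :: real
  assumes "x \<in> {0<..<1}"
  shows "sin (pi * x) > 0"
  using assms by (intro sin_gt_zero) auto

lemma Gamma_reflection_real:
  fixes x :: real
  shows "Gamma x * Gamma (1 - x) = pi / sin (pi * x)"
proof -
  have "complex_of_real (Gamma x * Gamma (1 - x)) = of_real (pi / sin (pi * x))"
    using Gamma_reflection_complex[of "of_real x"]
    by (simp flip: Gamma_complex_of_real sin_of_real)
  then show ?thesis by (simp only: of_real_eq_iff)
qed

lemma ln_Gamma_reflection_real:
  fixes x :: real
  assumes "x \<in> {0<..<1}"
  shows "ln_Gamma x + ln_Gamma (1 - x) = ln pi - ln (sin (pi * x))"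
proof -
  have "ln_Gamma x + ln_Gamma (1 - x) = ln (Gamma x * Gamma (1 - x))"
    using assms Gamma_real_pos[of x] Gamma_real_pos[of "1 - x"]
    by (simp add: ln_Gamma_real_pos ln_mult_pos)
  also have "\<dots> = ln pi - ln (sin (pi * x))"
    using sin_pi_pos[OF assms] by (simp add: Gamma_reflection_real ln_div)
  finally show ?thesis .
qed

lemma Digamma_reflection_real:
  fixes x :: real
  assumes "x \<in> {0<..<1}"
  shows "Digamma x - Digamma (1 - x) = - pi * cos (pi * x) / sin (pi * x)"
  by (rule DERIV_eq_on_open[OF _ ln_Gamma_reflection_real, where S = "{0<..<1}"])
     (use assms sin_pi_pos in \<open>force intro!: derivative_eq_intros simp: field_simps\<close>)+

lemma Polygamma_1_reflection_real:
  fixes x :: real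
  assumes "x \<in> {0<..<1}"
  shows "Polygamma 1 x + Polygamma 1 (1 - x) = pi\<^sup>2 / (sin (pi * x))\<^sup>2"
proof (rule DERIV_eq_on_open[OF _ Digamma_reflection_real, where S = "{0<..<1}"
      and f' = "\<lambda>x. Polygamma 1 x + Polygamma 1 (1 - x)"
      and g' = "\<lambda>x. pi\<^sup>2 / (sin (pi * x))\<^sup>2"])
  fix x :: real assume x: "x \<in> {0<..<1}"
  show "((\<lambda>x. Digamma x - Digamma (1 - x)) has_real_derivative
          Polygamma 1 x + Polygamma 1 (1 - x)) (at x)"
    using x by (auto intro!: derivative_eq_intros elim!: nonpos_Ints_cases)
  show "((\<lambda>x. - pi * cos (pi * x) / sin (pi * x)) has_real_derivative
          pi\<^sup>2 / (sin (pi * x))\<^sup>2) (at x)"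
    \<comment> \<open>The quotient rule gives the numerator
      \<open>pi^2 * (sin^2 + cos^2)\<close>.\<close>
    using sin_pi_pos[OF x] sin_cos_squared_add[of "pi * x"]
    by (auto intro!: derivative_eq_intros simp: divide_simps power2_eq_square) algebra
qed (use assms in auto)

lemma Polygamma_2_reflection_real:
  fixes x :: real
  assumes "x \<in> {0<..<1}"
  shows "Polygamma 2 x - Polygamma 2 (1 - x) = - 2 * pi ^ 3 * cos (pi * x) / sin (pi * x) ^ 3"
proof (rule DERIV_eq_on_open[OF _ Polygamma_1_reflection_real, where S = "{0<..<1}"
      and f' = "\<lambda>x. Polygamma 2 x - Polygamma 2 (1 - x)"
      and g' = "\<lambda>x. - 2 * pi ^ 3 * cos (pi * x) / sin (pi * x) ^ 3"])
  fix x :: real assume x: "x \<in> {0<..<1}"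
  show "((\<lambda>x. Polygamma 1 x + Polygamma 1 (1 - x)) has_real_derivative
          Polygamma 2 x - Polygamma 2 (1 - x)) (at x)"
    using x by (auto intro!: derivative_eq_intros elim!: nonpos_Ints_cases simp: numeral_2_eq_2)
  show "((\<lambda>x. pi\<^sup>2 / (sin (pi * x))\<^sup>2) has_real_derivative
          - 2 * pi ^ 3 * cos (pi * x) / sin (pi * x) ^ 3) (at x)"
    using sin_pi_pos[OF x]
    by (auto intro!: derivative_eq_intros simp: divide_simps eval_nat_numeral)
qed (use assms in auto)

lemma Polygamma_3_reflection_real:
  fixes x :: real
  assumes "x \<in> {0<..<1}"
  shows "Polygamma 3 x + Polygamma 3 (1 - x) =
           2 * pi ^ 4 * (1 + 2 * (cos (pi * x))\<^sup>2) / sin (pi * x) ^ 4"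
proof (rule DERIV_eq_on_open[OF _ Polygamma_2_reflection_real, where S = "{0<..<1}"
      and f' = "\<lambda>x. Polygamma 3 x + Polygamma 3 (1 - x)"
      and g' = "\<lambda>x. 2 * pi ^ 4 * (1 + 2 * (cos (pi * x))\<^sup>2) / sin (pi * x) ^ 4"])
  fix x :: real assume x: "x \<in> {0<..<1}"
  show "((\<lambda>x. Polygamma 2 x - Polygamma 2 (1 - x)) has_real_derivative
          Polygamma 3 x + Polygamma 3 (1 - x)) (at x)"
    using x by (auto intro!: derivative_eq_intros elim!: nonpos_Ints_cases simp: eval_nat_numeral)
  show "((\<lambda>x. - 2 * pi ^ 3 * cos (pi * x) / sin (pi * x) ^ 3) has_real_derivative
          2 * pi ^ 4 * (1 + 2 * (cos (pi * x))\<^sup>2) / sin (pi * x) ^ 4) (at x)"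
    using sin_pi_pos[OF x] sin_cos_squared_add[of "pi * x"]
    by (auto intro!: derivative_eq_intros simp: divide_simps eval_nat_numeral) algebra
qed (use assms in auto)

lemma inverse_odd_fourth_powers_sums: "(\<lambda>n. 1 / (2 * real n + 1) ^ 4) sums (pi ^ 4 / 96)"
proof -
  \<comment> \<open>At \<open>1/2\<close> the sine is 1, the cosine is 0, and the two polygamma
    terms coincide.\<close>
  have "Polygamma 3 (1/2 :: real) = pi ^ 4"
    using Polygamma_3_reflection_real[of "1/2"] by simp
  moreover have "(\<lambda>n. inverse ((1/2 + real n) ^ Suc 3)) sums
                   ((-1) ^ Suc 3 * Polygamma 3 (1/2 :: real) / fact 3)"
    by (rule Polygamma_LIMSEQ) auto
  ultimately have "(\<lambda>n. inverse ((1/2 + real n) ^ 4)) sums (pi ^ 4 / 6)"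
    by (simp add: fact_numeral)
  \<comment> \<open>The factor \<open>1/16\<close> rescales \<open>1/2 + n\<close> to
    \<open>2 n + 1\<close>.\<close>
  then have "(\<lambda>n. 1/16 * inverse ((1/2 + real n) ^ 4)) sums (1/16 * (pi ^ 4 / 6))"
    by (rule sums_mult)
  moreover have "1/16 * inverse ((1/2 + real n) ^ 4) = 1 / (2 * real n + 1) ^ 4" for n
  proof -
    have "2 * real n + 1 = 2 * (1/2 + real n)" by simp
    then show ?thesis by (simp only: power_mult_distrib) (simp add: field_simps)
  qed
  ultimately show ?thesis by simp
qed

section \<open>The Wilf-Zeilberger pair\<close>

text \<open>Value at \<open>y = 0\<close> of the \<open>n\<close>-th summand of
  \<open>A\<^sub>k\<close> times the factors \<open>2 j (j^2 - y) / (2 j - 1)\<close>,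
  \<open>1 \<le> j \<le> k\<close>, accumulated by iterating the recurrence. The outer division is
  the summand's factor for \<open>j = 0\<close>.\<close>

definition wz_weight :: "nat \<Rightarrow> nat \<Rightarrow> real" where
  "wz_weight n k =
     (\<Prod>j=1..k. 2 * real j ^ 3 / ((2 * real j - 1) * (2 * real n + 2 * real j + 1)\<^sup>2))
     / (2 * real n + 1)\<^sup>2"

text \<open>Logarithmic derivative in \<open>y\<close> at 0 of the \<open>n\<close>-th summand of
  \<open>A\<^sub>k\<close>; the accumulated recurrence factors contribute
  \<open>- harmonic2 k\<close>.\<close>

definition odd_squares_window :: "nat \<Rightarrow> nat \<Rightarrow> real" where
  "odd_squares_window n k = (\<Sum>j\<le>k. 1 / (2 * real n + 2 * real j + 1)\<^sup>2)"

text \<open>Twice the coefficient of \<open>y\<close> in the product behind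
  \<open>wz_weight\<close>; at \<open>k = 0\<close> this belongs to
  \<open>2 / ((2 n + 1)^2 - y)\<close>.\<close>

definition wz_F :: "nat \<Rightarrow> nat \<Rightarrow> real" where
  "wz_F n k = 2 * wz_weight n k * (odd_squares_window n k - harmonic2 k)"

text \<open>The same coefficient times a rational certificate, which at \<open>n = 0\<close>
  supplies the factor \<open>3 k + 2\<close> of the series.\<close>

definition wz_G :: "nat \<Rightarrow> nat \<Rightarrow> real" where
  "wz_G n k = (2 * real n + 3 * real k + 2) / (2 * real k + 1)
     * wz_weight n k * (odd_squares_window n k - harmonic2 k)"

lemma wz_weight_Suc:
  "wz_weight n (Suc k) = wz_weight n k
     * (2 * (real k + 1) ^ 3 / ((2 * (real k + 1) - 1) * (2 * real n + 1 + 2 * (real k + 1))\<^sup>2))"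
  by (simp add: wz_weight_def algebra_simps)

text \<open>Shifting the window of odd numbers by one step trades its first member
  \<open>2 n + 1\<close> for the new last one \<open>2 n + 2 k + 3\<close>.\<close>

lemma wz_weight_shift:
  "wz_weight (Suc n) k
     = wz_weight n k * (2 * real n + 1)\<^sup>2 / (2 * real n + 1 + 2 * (real k + 1))\<^sup>2"
proof (induction k)
  case 0
  show ?case by (simp add: wz_weight_def algebra_simps)
next
  case (Suc k)
  have "2 * real n + 1 + 2 * (real k + 1) > 0" by (intro add_pos_pos add_nonneg_pos) auto
  then show ?case
    by (simp add: wz_weight_Suc Suc.IH algebra_simps)
qed

lemma harmonic2_Suc: "harmonic2 (Suc k) = harmonic2 k + 1 / (real k + 1)\<^sup>2"
  by (simp add: harmonic2_def add.commute)

lemma odd_squares_window_Suc: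
  "odd_squares_window n (Suc k)
     = odd_squares_window n k + 1 / (2 * real n + 1 + 2 * (real k + 1))\<^sup>2"
  by (simp add: odd_squares_window_def algebra_simps)

lemma odd_squares_window_shift:
  "odd_squares_window (Suc n) k
     = odd_squares_window n k + 1 / (2 * real n + 1 + 2 * (real k + 1))\<^sup>2 - 1 / (2 * real n + 1)\<^sup>2"
proof (induction k)
  case 0
  show ?case by (simp add: odd_squares_window_def algebra_simps)
next
  case (Suc k)
  then show ?case by (simp add: odd_squares_window_Suc algebra_simps)
qed

text \<open>
  Here \<open>m = 2n + 1\<close>, \<open>K = k + 1\<close>, and \<open>w\<close>, \<open>d\<close> stand for the weight and the harmonic
  factor at \<open>(n, k)\<close>.
\<close>
lemma wz_identity_aux:
  fixes m K w d :: real
  assumes "m > 0" "K \<ge> 1"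
  defines "M \<equiv> m + 2 * K"
  shows "2 * w * d - 2 * (w * (2 * K ^ 3 / ((2 * K - 1) * M\<^sup>2))) * (d + 1 / M\<^sup>2 - 1 / K\<^sup>2)
       = (m + 3 * K - 2) / (2 * K - 1) * w * d
         - (m + 3 * K) / (2 * K - 1) * (w * m\<^sup>2 / M\<^sup>2) * (d + 1 / M\<^sup>2 - 1 / m\<^sup>2)"
proof -
  have nz: "m \<noteq> 0" "K \<noteq> 0" "M \<noteq> 0" "2 * K - 1 \<noteq> 0"
    using assms by auto
  \<comment> \<open>Both sides are affine in \<open>d\<close>, so it suffices to match the
    coefficient of \<open>d\<close> (the telescoping at \<open>y = 0\<close>) and the part free of
    \<open>d\<close>.\<close>
  have d_coeff: "2 * (2 * K - 1) * M\<^sup>2 - 4 * K ^ 3 = (m + 3 * K - 2) * M\<^sup>2 - (m + 3 * K) * m\<^sup>2"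
    unfolding M_def by algebra
  have const: "4 * K ^ 3 * (1 / M\<^sup>2 - 1 / K\<^sup>2) = (m + 3 * K) * m\<^sup>2 * (1 / M\<^sup>2 - 1 / m\<^sup>2)"
  proof -
    have "4 * K ^ 3 - 4 * K * M\<^sup>2 = (m + 3 * K) * (m\<^sup>2 - M\<^sup>2)"
      unfolding M_def by algebra
    moreover have "4 * K ^ 3 * (1 / M\<^sup>2 - 1 / K\<^sup>2) = (4 * K ^ 3 - 4 * K * M\<^sup>2) / M\<^sup>2"
      using nz by (simp add: right_diff_distrib diff_divide_distrib power3_eq_cube power2_eq_square)
    moreover have "(m + 3 * K) * m\<^sup>2 * (1 / M\<^sup>2 - 1 / m\<^sup>2) = (m + 3 * K) * (m\<^sup>2 - M\<^sup>2) / M\<^sup>2"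
      using nz by (simp add: right_diff_distrib diff_divide_distrib)
    ultimately show ?thesis by simp
  qed
  define c where "c = w / ((2 * K - 1) * M\<^sup>2)"
  have w_d: "2 * w * d = c * (2 * (2 * K - 1) * M\<^sup>2 * d)"
    and w_Suc: "w * (2 * K ^ 3 / ((2 * K - 1) * M\<^sup>2)) = c * (2 * K ^ 3)"
    and g: "(m + 3 * K - 2) / (2 * K - 1) * w * d = c * ((m + 3 * K - 2) * M\<^sup>2 * d)"
    and g_Suc: "(m + 3 * K) / (2 * K - 1) * (w * m\<^sup>2 / M\<^sup>2) = c * ((m + 3 * K) * m\<^sup>2)"
    using nz by (simp_all add: c_def divide_simps)
  have "c * (2 * (2 * K - 1) * M\<^sup>2 * d) - 2 * (c * (2 * K ^ 3)) * (d + 1 / M\<^sup>2 - 1 / K\<^sup>2)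
      = c * ((2 * (2 * K - 1) * M\<^sup>2 - 4 * K ^ 3) * d - 4 * K ^ 3 * (1 / M\<^sup>2 - 1 / K\<^sup>2))"
    by algebra
  also have "\<dots> = c * (((m + 3 * K - 2) * M\<^sup>2 - (m + 3 * K) * m\<^sup>2) * d
      - (m + 3 * K) * m\<^sup>2 * (1 / M\<^sup>2 - 1 / m\<^sup>2))"
    by (simp only: d_coeff const)
  also have "\<dots> = c * ((m + 3 * K - 2) * M\<^sup>2 * d)
      - c * ((m + 3 * K) * m\<^sup>2) * (d + 1 / M\<^sup>2 - 1 / m\<^sup>2)"
    by algebra
  finally show ?thesis
    unfolding w_d w_Suc g g_Suc .
qed

lemma wz_identity: "wz_F n k - wz_F n (Suc k) = wz_G n k - wz_G (Suc n) k"
proof -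
  define m K w d where "m = 2 * real n + 1" and "K = real k + 1"
    and "w = wz_weight n k" and "d = odd_squares_window n k - harmonic2 k"
  have "wz_F n k = 2 * w * d"
    by (simp add: wz_F_def w_def d_def)
  moreover have "wz_F n (Suc k) = 2 * (w * (2 * K ^ 3 / ((2 * K - 1) * (m + 2 * K)\<^sup>2)))
      * (d + 1 / (m + 2 * K)\<^sup>2 - 1 / K\<^sup>2)"
    unfolding wz_F_def wz_weight_Suc odd_squares_window_Suc harmonic2_Suc m_def K_def w_def d_def
    by (simp add: add_diff_eq diff_diff_eq diff_add_eq)
  moreover have "wz_G n k = (m + 3 * K - 2) / (2 * K - 1) * w * d"
    by (simp add: wz_G_def m_def K_def w_def d_def algebra_simps)
  moreover have "wz_G (Suc n) k = (m + 3 * K) / (2 * K - 1) * (w * m\<^sup>2 / (m + 2 * K)\<^sup>2)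
      * (d + 1 / (m + 2 * K)\<^sup>2 - 1 / m\<^sup>2)"
  proof -
    have "2 * real (Suc n) + 3 * real k + 2 = m + 3 * K" "2 * real k + 1 = 2 * K - 1"
      by (simp_all add: m_def K_def)
    moreover have "odd_squares_window (Suc n) k - harmonic2 k
        = d + 1 / (m + 2 * K)\<^sup>2 - 1 / m\<^sup>2"
      unfolding odd_squares_window_shift m_def K_def d_def by simp
    ultimately show ?thesis
      unfolding wz_G_def wz_weight_shift by (simp only: m_def K_def w_def)
  qed
  ultimately show ?thesis
    using wz_identity_aux[of m K w d] by (simp add: m_def K_def)
qed

section \<open>Estimates and convergence\<close>

text \<open>The worst case is \<open>m = 0\<close>, where the claim is
  \<open>8 j^3 \<le> (2 j - 1) (2 j + 1)^2\<close>. In the application \<open>m\<close> is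
  \<open>2 n\<close>, not \<open>2 n + 1\<close>.\<close>

lemma wz_weight_factor_le:
  fixes m j :: real
  assumes "m \<ge> 0" "j \<ge> 1"
  shows "2 * j ^ 3 / ((2 * j - 1) * (m + 2 * j + 1)\<^sup>2) \<le> 1 / 4"
proof -
  have "8 * j ^ 3 \<le> (2 * j - 1) * (2 * j + 1)\<^sup>2"
  proof -
    have "(2 * j - 1) * (2 * j + 1)\<^sup>2 = 8 * j ^ 3 + (2 * j * (j - 1) + 2 * j\<^sup>2 - 1)"
      by algebra
    moreover have "j\<^sup>2 \<ge> 1" using assms by simp
    moreover have "j * (j - 1) \<ge> 0" using assms by simp
    ultimately show ?thesis by linarith
  qed
  also have "\<dots> \<le> (2 * j - 1) * (m + 2 * j + 1)\<^sup>2"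
    using assms by (intro mult_left_mono power_mono) auto
  finally show ?thesis
    using assms by (simp add: divide_simps)
qed

lemma wz_weight_nonneg: "wz_weight n k \<ge> 0"
  unfolding wz_weight_def by (intro divide_nonneg_nonneg prod_nonneg) auto

lemma wz_weight_le: "wz_weight n k \<le> (1/4) ^ k / (2 * real n + 1)\<^sup>2"
proof -
  have "(\<Prod>j=1..k. 2 * real j ^ 3 / ((2 * real j - 1) * (2 * real n + 2 * real j + 1)\<^sup>2))
      \<le> (\<Prod>j=1..k. 1/4)"
    by (intro prod_mono conjI wz_weight_factor_le) auto
  then show ?thesis
    unfolding wz_weight_def by (intro divide_right_mono) auto
qed

lemma odd_squares_window_bounds: "odd_squares_window n k \<in> {0..real k + 1}"
proof -
  have "odd_squares_window n k \<le> (\<Sum>j\<le>k. 1)"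
    unfolding odd_squares_window_def by (intro sum_mono) auto
  moreover have "odd_squares_window n k \<ge> 0"
    unfolding odd_squares_window_def by (intro sum_nonneg) auto
  ultimately show ?thesis by simp
qed

lemma harmonic2_bounds: "harmonic2 k \<in> {0..real k}"
proof -
  have "harmonic2 k \<le> (\<Sum>j=1..k. 1)"
    unfolding harmonic2_def by (intro sum_mono) auto
  moreover have "harmonic2 k \<ge> 0"
    unfolding harmonic2_def by (intro sum_nonneg) auto
  ultimately show ?thesis by simp
qed

text \<open>The harmonic factor grows at most linearly in \<open>k\<close>, against a geometric
  weight. Separating \<open>n\<close> from \<open>k\<close> in the bound serves both the sums over
  \<open>n\<close> and the limit in \<open>k\<close>.\<close>

lemma wz_product_bound:
  "\<bar>wz_weight n k * (odd_squares_window n k - harmonic2 k)\<bar>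
     \<le> (1/4) ^ k * (real k + 1) / (2 * real n + 1)\<^sup>2"
proof -
  have "\<bar>odd_squares_window n k - harmonic2 k\<bar> \<le> real k + 1"
    using odd_squares_window_bounds[of n k] harmonic2_bounds[of k] by auto
  then have "wz_weight n k * \<bar>odd_squares_window n k - harmonic2 k\<bar>
      \<le> (1/4) ^ k / (2 * real n + 1)\<^sup>2 * (real k + 1)"
    using wz_weight_le by (intro mult_mono) auto
  then show ?thesis by (simp add: abs_mult wz_weight_nonneg)
qed

lemma wz_F_bound:
  "\<bar>wz_F n k\<bar> \<le> 2 * ((1/4) ^ k * (real k + 1)) * (1 / (2 * real n + 1)\<^sup>2)"
  using wz_product_bound[of n k] unfolding wz_F_def mult.assoc abs_mult by simp

lemma summable_inverse_odd_squares: "summable (\<lambda>n. 1 / (2 * real n + 1)\<^sup>2)"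
proof (rule summable_comparison_test)
  show "summable (\<lambda>n. 1 / (real n + 1)\<^sup>2)"
    using inverse_squares_sums by (simp add: sums_iff add.commute)
  show "\<exists>N. \<forall>n\<ge>N. norm (1 / (2 * real n + 1)\<^sup>2) \<le> 1 / (real n + 1)\<^sup>2"
    by (auto intro!: frac_le power_mono)
qed

lemma summable_abs_wz_F: "summable (\<lambda>n. \<bar>wz_F n k\<bar>)"
  by (rule summable_comparison_test'[OF summable_mult[OF summable_inverse_odd_squares]])
     (use wz_F_bound in auto)

lemma summable_wz_F: "summable (\<lambda>n. wz_F n k)"
  using summable_abs_wz_F by (rule summable_rabs_cancel)

text \<open>For fixed \<open>k\<close> the certificate grows linearly in \<open>n\<close> while the
  weight decays at least quadratically.\<close>

lemma wz_G_tendsto_0: "(\<lambda>n. wz_G n k) \<longlonglongrightarrow> 0"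
proof (rule Lim_null_comparison)
  define c where "c = (1/4) ^ k * (real k + 1) / (2 * real k + 1)"
  show "\<forall>\<^sub>F n in sequentially.
          norm (wz_G n k) \<le> c * ((2 * real n + 3 * real k + 2) / (2 * real n + 1)\<^sup>2)"
  proof (rule always_eventually, rule allI)
    fix n
    have "norm (wz_G n k) = (2 * real n + 3 * real k + 2) / (2 * real k + 1)
            * \<bar>wz_weight n k * (odd_squares_window n k - harmonic2 k)\<bar>"
      by (simp add: wz_G_def abs_mult)
    also have "\<dots> \<le> (2 * real n + 3 * real k + 2) / (2 * real k + 1)
            * ((1/4) ^ k * (real k + 1) / (2 * real n + 1)\<^sup>2)"
      by (intro mult_left_mono wz_product_bound) auto
    finally show "norm (wz_G n k) \<le> c * ((2 * real n + 3 * real k + 2) / (2 * real n + 1)\<^sup>2)"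
      by (simp add: c_def mult_ac)
  qed
  have "(\<lambda>n. (2 * real n + 3 * real k + 2) / (2 * real n + 1)\<^sup>2) \<longlonglongrightarrow> 0"
    by real_asymp
  then show "(\<lambda>n. c * ((2 * real n + 3 * real k + 2) / (2 * real n + 1)\<^sup>2)) \<longlonglongrightarrow> 0"
    by (rule tendsto_mult_right_zero)
qed

section \<open>Summation of the pair\<close>

text \<open>Summing \<open>wz_identity\<close> over \<open>n\<close> telescopes its right-hand side,
  leaving the boundary term at \<open>n = 0\<close>.\<close>

lemma suminf_wz_F_diff: "(\<Sum>n. wz_F n k) - (\<Sum>n. wz_F n (Suc k)) = wz_G 0 k"
proof -
  have "(\<lambda>n. wz_G n k - wz_G (Suc n) k) sums (wz_G 0 k - 0)"
    by (rule telescope_sums'[OF wz_G_tendsto_0])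
  moreover have "(\<lambda>n. wz_F n k - wz_F n (Suc k)) sums ((\<Sum>n. wz_F n k) - (\<Sum>n. wz_F n (Suc k)))"
    by (intro sums_diff summable_sums summable_wz_F)
  ultimately show ?thesis
    unfolding wz_identity by (simp add: sums_iff)
qed

lemma suminf_wz_F_tendsto_0: "(\<lambda>k. \<Sum>n. wz_F n k) \<longlonglongrightarrow> 0"
proof (rule Lim_null_comparison)
  define c where "c = (\<Sum>n. 1 / (2 * real n + 1)\<^sup>2)"
  show "\<forall>\<^sub>F k in sequentially. norm (\<Sum>n. wz_F n k) \<le> 2 * ((1/4) ^ k * (real k + 1)) * c"
  proof (rule always_eventually, rule allI)
    fix k
    have "norm (\<Sum>n. wz_F n k) \<le> (\<Sum>n. \<bar>wz_F n k\<bar>)"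
      using summable_norm[of "\<lambda>n. wz_F n k"] summable_abs_wz_F by simp
    also have "\<dots> \<le> (\<Sum>n. 2 * ((1/4) ^ k * (real k + 1)) * (1 / (2 * real n + 1)\<^sup>2))"
      by (intro suminf_le wz_F_bound summable_abs_wz_F summable_mult summable_inverse_odd_squares)
    also have "\<dots> = 2 * ((1/4) ^ k * (real k + 1)) * c"
      unfolding c_def by (rule suminf_mult[OF summable_inverse_odd_squares])
    finally show "norm (\<Sum>n. wz_F n k) \<le> 2 * ((1/4) ^ k * (real k + 1)) * c" .
  qed
  have "(\<lambda>k. 2 * ((1/4) ^ k * (real k + 1))) \<longlonglongrightarrow> 0"
    by real_asymp
  then show "(\<lambda>k. 2 * ((1/4) ^ k * (real k + 1)) * c) \<longlonglongrightarrow> 0"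
    by (rule tendsto_mult_left_zero)
qed

lemma suminf_wz_F_0: "(\<Sum>n. wz_F n 0) = pi ^ 4 / 48"
proof -
  have "wz_F n 0 = 2 * (1 / (2 * real n + 1) ^ 4)" for n
    by (simp add: wz_F_def wz_weight_def odd_squares_window_def harmonic2_def
                  eval_nat_numeral mult_ac)
  moreover have "(\<lambda>n. 2 * (1 / (2 * real n + 1) ^ 4)) sums (2 * (pi ^ 4 / 96))"
    by (rule sums_mult[OF inverse_odd_fourth_powers_sums])
  ultimately show ?thesis by (simp add: sums_iff)
qed

section \<open>Boundary terms as terms of the series\<close>

text \<open>The extra \<open>2 k + 1\<close> completes the product of the \<open>2 j - 1\<close> to
  that of the \<open>2 j + 1\<close>, so the denominator becomes a cube, \<open>8^k\<close> times
  the cube of \<open>pochhammer (3/2) k\<close>.\<close>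

lemma wz_weight_0:
  "wz_weight 0 k / (2 * real k + 1) = pochhammer 1 k ^ 3 / (pochhammer (3/2) k ^ 3 * 4 ^ k)"
proof (induction k)
  case 0
  show ?case by (simp add: wz_weight_def)
next
  case (Suc k)
  have "pochhammer (1::real) (Suc k) ^ 3 / (pochhammer (3/2) (Suc k) ^ 3 * 4 ^ Suc k)
      = pochhammer 1 k ^ 3 / (pochhammer (3/2) k ^ 3 * 4 ^ k)
        * ((1 + real k) ^ 3 / ((3/2 + real k) ^ 3 * 4))"
    by (simp add: pochhammer_Suc power_mult_distrib)
  also have "\<dots> = wz_weight 0 k / (2 * real k + 1) * ((1 + real k) ^ 3 / ((3/2 + real k) ^ 3 * 4))"
    by (simp only: Suc.IH)
  also have "\<dots> = wz_weight 0 (Suc k) / (2 * real (Suc k) + 1)"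
  proof -
    have "3/2 + real k = (2 * real k + 3) / 2" by simp
    moreover have "wz_weight 0 (Suc k) = wz_weight 0 k
        * (2 * (1 + real k) ^ 3 / ((2 * real k + 1) * (2 * real k + 3)\<^sup>2))"
      by (simp add: wz_weight_Suc algebra_simps)
    moreover have "2 * real (Suc k) + 1 = 2 * real k + 3" by simp
    ultimately show ?thesis
      by (simp only: power_divide) (simp add: divide_simps power3_eq_cube power2_eq_square)
  qed
  finally show ?case by simp
qed

text \<open>The even-indexed terms of \<open>harmonic2 (2 * k + 1)\<close> add up to a quarter of
  \<open>harmonic2 k\<close>, which turns the coefficient 1 into \<open>5/4\<close>.\<close>

lemma odd_squares_window_0:
  "odd_squares_window 0 k - harmonic2 k = harmonic2 (2 * k + 1) - 5 / 4 * harmonic2 k"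
proof (induction k)
  case 0
  show ?case by (simp add: odd_squares_window_def harmonic2_def)
next
  case (Suc k)
  have "1 / (2 * real k + 1 + 1)\<^sup>2 = 1/4 * (1 / (real k + 1)\<^sup>2)"
    by (simp add: divide_simps power2_eq_square) (simp add: algebra_simps)
  moreover have "harmonic2 (2 * Suc k + 1) = harmonic2 (2 * k + 1)
      + 1 / (2 * real k + 1 + 1)\<^sup>2 + 1 / (1 + 2 * (real k + 1))\<^sup>2"
    using harmonic2_Suc[of "2 * k + 1"] harmonic2_Suc[of "2 * k + 2"] by (simp add: algebra_simps)
  moreover have "odd_squares_window 0 (Suc k)
      = odd_squares_window 0 k + 1 / (1 + 2 * (real k + 1))\<^sup>2"
    by (simp add: odd_squares_window_Suc)
  ultimately show ?case
    using Suc.IH by (simp only: harmonic2_Suc) (simp only: algebra_simps)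
qed

theorem theorem1p1:
  shows "(\<lambda>k::nat. (3 * real k + 2)
            * ((pochhammer (1::real) k) ^ 3 / ((pochhammer (3 / 2 :: real) k) ^ 3 * 4 ^ k))
            * (harmonic2 (2 * k + 1) - 5 / 4 * harmonic2 k))
         sums (pi ^ 4 / 48)"
proof -
  \<comment> \<open>A second telescoping, now in \<open>k\<close>, equates the sum of the boundary
    terms \<open>wz_G 0 k\<close> with the column sum at \<open>k = 0\<close>.\<close>
  have "(\<lambda>k. (\<Sum>n. wz_F n k) - (\<Sum>n. wz_F n (Suc k))) sums ((\<Sum>n. wz_F n 0) - 0)"
    by (rule telescope_sums'[OF suminf_wz_F_tendsto_0])
  then have "(\<lambda>k. wz_G 0 k) sums (pi ^ 4 / 48)"
    by (simp only: suminf_wz_F_diff suminf_wz_F_0 diff_zero)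
  moreover have "wz_G 0 k = (3 * real k + 2) * (wz_weight 0 k / (2 * real k + 1))
      * (odd_squares_window 0 k - harmonic2 k)" for k
    by (simp add: wz_G_def)
  ultimately show ?thesis
    by (simp only: wz_weight_0 odd_squares_window_0)
qed

end
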